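(* Let $U\subset\mathbb{R}^n$ be open, let $\phi\in C^2(U)$, and let $x\in U$. Then, as $\varepsilon\to0^+$ (over $\varepsilon$ with $\overline{B_\varepsilon(x)}\subset U$), $$\frac12\bigl(S^+[\phi](x)+S^-[\phi](x)\bigr)=\phi(x)+\frac{\varepsilon^2}{2}\,\frac{\langle D^2\phi(x)D\phi(x),D\phi(x)\rangle}{1+|D\phi(x)|^2}+o(\varepsilon^2).$$
   Context: $B_\varepsilon(x)$ is the open ball in $\mathbb{R}^n$ of radius $\varepsilon$ centered at $x$. For a continuous function $u$ defined on a neighborhood of $\overline{B_\varepsilon(x)}$, define (the dependence on $\varepsilon$ is suppressed in the notation) $$S^+[u](x)=\sup_{|h|\le\varepsilon}\Bigl(u(x+h)+\sqrt{\varepsilon^2-|h|^2}\Bigr),\qquad S^-[u](x)=\inf_{|h|\le\varepsilon}\Bigl(u(x+h)-\sqrt{\varepsilon^2-|h|^2}\Bigr).$$ *)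

theory Defs
  imports "HOL-Analysis.Analysis" "HOL-Library.Landau_Symbols"
begin

definition gradient :: "(real ^ 'n \<Rightarrow> real) \<Rightarrow> real ^ 'n \<Rightarrow> real ^ 'n" where
  "gradient f x = (THE D. GDERIV f x :> D)"

lemma gradient_eqI:
  assumes "GDERIV f x :> D"
  shows "gradient f x = D"
  unfolding gradient_def
proof (rule the_equality, rule assms)
  fix E assume "GDERIV f x :> E"
  then have "(\<lambda>h. inner h E) = (\<lambda>h. inner h D)"
    using assms has_derivative_unique unfolding gderiv_def by blast
  then have "\<forall>h. inner h E = inner h D"
    by (simp add: fun_eq_iff)
  then show "E = D"
    by (simp only: vector_eq_ldot)
qed

definition hessian :: "(real ^ 'n \<Rightarrow> real) \<Rightarrow> real ^ 'n \<Rightarrow> real ^ 'n ^ 'n" where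
  "hessian f x = jacobian (gradient f) (at x)"

(* Twice continuously differentiable on an open set U. All derivatives are Frechet derivatives
   at interior points, so only the values of f on U matter. Continuity of f and of its gradient
   follows from their differentiability. *)
definition C2_on :: "(real ^ 'n) set \<Rightarrow> (real ^ 'n \<Rightarrow> real) \<Rightarrow> bool" where
  "C2_on U f \<longleftrightarrow>
     (\<forall>x\<in>U. f differentiable (at x)) \<and>
     (\<forall>x\<in>U. gradient f differentiable (at x)) \<and>
     continuous_on U (hessian f)"

(* Intended for u continuous on a neighbourhood of cball x \<epsilon> with \<epsilon> > 0; compactness then makes
   the supremum and the infimum finite. *)
definition S_plus :: "real \<Rightarrow> (real ^ 'n \<Rightarrow> real) \<Rightarrow> real ^ 'n \<Rightarrow> real" where
  "S_plus \<epsilon> u x = (SUP h\<in>{h. norm h \<le> \<epsilon>}. u (x + h) + sqrt (\<epsilon>\<^sup>2 - (norm h)\<^sup>2))"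

definition S_minus :: "real \<Rightarrow> (real ^ 'n \<Rightarrow> real) \<Rightarrow> real ^ 'n \<Rightarrow> real" where
  "S_minus \<epsilon> u x = (INF h\<in>{h. norm h \<le> \<epsilon>}. u (x + h) - sqrt (\<epsilon>\<^sup>2 - (norm h)\<^sup>2))"

end

theory Submission
  imports Defs
begin

text \<open>
  Write \<open>p\<close> for the gradient and \<open>A\<close> for the Hessian of \<open>\<phi>\<close> at \<open>x\<close>, and
  \<open>N = sqrt (1 + |p|\<^sup>2)\<close>. The linear problem of maximising \<open>p \<bullet> h + sqrt (\<epsilon>\<^sup>2 - |h|\<^sup>2)\<close> over
  \<open>|h| \<le> \<epsilon>\<close> asks for the point of the upper half sphere of radius \<open>\<epsilon>\<close> that is highest in direction
  \<open>(p, 1)\<close>: it is attained at \<open>m = (\<epsilon> / N) p\<close> with value \<open>\<epsilon> N\<close>, and away from \<open>m\<close> the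
  value drops by at least \<open>N |h - m|\<^sup>2 / (2 \<epsilon>)\<close>. The quadratic Taylor term varies only by
  \<open>O(\<epsilon> |h - m|)\<close>, so that drop absorbs its variation up to \<open>O(\<epsilon>\<^sup>3)\<close>, and
  \<open>S\<^sup>+[\<phi>](x) = \<phi> x + \<epsilon> N + (A m \<bullet> m) / 2 + o(\<epsilon>\<^sup>2)\<close>. Since \<open>S\<^sup>-[\<phi>] = - S\<^sup>+[- \<phi>]\<close>, the terms
  \<open>\<epsilon> N\<close> cancel in the average.
\<close>

text \<open>The Riesz representative of the derivative \<open>f'\<close> is
  \<open>adjoint f' 1\<close>, so differentiability alone makes the description in
  \<open>gradient\<close> meaningful.\<close>

lemma GDERIV_gradient:
  fixes f :: "real ^ 'n \<Rightarrow> real"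
  assumes "f differentiable (at x)"
  shows "GDERIV f x :> gradient f x"
proof -
  obtain f' where f': "(f has_derivative f') (at x)"
    using assms by (auto simp: differentiable_def)
  then interpret bounded_linear f' by (rule has_derivative_bounded_linear)
  have "f' h = h \<bullet> adjoint f' 1" for h
    using adjoint_works[OF linear_axioms, of h 1] by simp
  then have "GDERIV f x :> adjoint f' 1"
    using f' unfolding gderiv_def by (metis (no_types, lifting) ext)
  then show ?thesis
    by (simp add: gradient_eqI)
qed

text \<open>Along the segment from \<open>x\<close> to \<open>x + h\<close>, the derivative of the
  Taylor remainder is the first-order remainder of \<open>G\<close> paired with \<open>h\<close>.
  The mean value theorem then turns the differentiability of \<open>G\<close> at \<open>x\<close>
  into the bound.\<close>

lemma second_order_Taylor_Peano:
  fixes f :: "'a::real_inner \<Rightarrow> real"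
  assumes r: "r > 0" and G: "\<And>y. y \<in> ball x r \<Longrightarrow> GDERIV f y :> G y"
    and A: "(G has_derivative A) (at x)" and e: "e > 0"
  shows "\<exists>d>0. \<forall>h. norm h < d \<longrightarrow>
           \<bar>f (x + h) - (f x + G x \<bullet> h + (A h \<bullet> h) / 2)\<bar> \<le> e * (norm h)\<^sup>2"
proof -
  interpret A: bounded_linear A using A by (rule has_derivative_bounded_linear)
  obtain d where d: "d > 0"
    "\<And>y. norm (y - x) < d \<Longrightarrow> norm (G y - G x - A (y - x)) \<le> e * norm (y - x)"
    using A e unfolding has_derivative_at_alt by blast
  have "\<bar>f (x + h) - (f x + G x \<bullet> h + (A h \<bullet> h) / 2)\<bar> \<le> e * (norm h)\<^sup>2"
    if h: "norm h < min d r" for h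
  proof -
    \<comment> \<open>The constant \<open>f x\<close> is left out: it cancels in
      \<open>g 1 - g 0\<close>, which is exactly the remainder to be estimated.\<close>
    define g where "g t = f (x + t *\<^sub>R h) - t * (G x \<bullet> h) - t\<^sup>2 / 2 * (A h \<bullet> h)" for t
    define g' where "g' t = (G (x + t *\<^sub>R h) - G x - A (t *\<^sub>R h)) \<bullet> h" for t
    have small: "norm (t *\<^sub>R h) \<le> norm h" if "0 \<le> t" "t \<le> 1" for t
      using that by (simp add: mult_left_le_one_le)
    have "(g has_real_derivative g' t) (at t)" if t: "0 \<le> t" "t \<le> 1" for t
    proof -
      have "x + t *\<^sub>R h \<in> ball x r"
        using small[OF t] h by (simp add: dist_norm)
      then have *: "(f has_derivative (\<lambda>v. v \<bullet> G (x + t *\<^sub>R h))) (at (x + t *\<^sub>R h))"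
        using G by (simp add: gderiv_def)
      have "((\<lambda>t. f (x + t *\<^sub>R h)) has_derivative (\<lambda>s. (s *\<^sub>R h) \<bullet> G (x + t *\<^sub>R h))) (at t)"
        by (rule has_derivative_compose[where f = "\<lambda>t. x + t *\<^sub>R h" and g = f, OF _ *]) (auto intro!: derivative_eq_intros)
      then have "((\<lambda>t. f (x + t *\<^sub>R h)) has_real_derivative (h \<bullet> G (x + t *\<^sub>R h))) (at t)"
        by (simp add: has_field_derivative_def mult_commute_abs)
      then show ?thesis
        unfolding g_def g'_def
        by (auto intro!: derivative_eq_intros
            simp: inner_diff_left inner_diff_right inner_commute A.scaleR)
    qed
    then obtain t where t: "0 < t" "t < 1" and eq: "g 1 - g 0 = g' t"
      using MVT2[of 0 1 g g'] by auto
    have "norm (t *\<^sub>R h) < d"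
      using small[of t] t h by linarith
    then have "norm (G (x + t *\<^sub>R h) - G x - A (t *\<^sub>R h)) \<le> e * norm (t *\<^sub>R h)"
      using d(2)[of "x + t *\<^sub>R h"] by simp
    also have "\<dots> \<le> e * norm h"
      using small[of t] t e by (intro mult_left_mono) auto
    finally have "\<bar>g' t\<bar> \<le> e * norm h * norm h"
      unfolding g'_def by (meson Cauchy_Schwarz_ineq2 mult_right_mono norm_ge_zero order_trans)
    then show ?thesis
      using eq by (simp add: g_def power2_eq_square algebra_simps)
  qed
  then show ?thesis
    using d(1) r by (intro exI[of _ "min d r"]) auto
qed

text \<open>Polarization: \<open>(h, s)\<close> and \<open>(\<epsilon> / N) (p, 1)\<close> both have
  norm \<open>\<epsilon>\<close>, so their inner product is \<open>\<epsilon>\<^sup>2\<close> minus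
  half their squared distance. Multiplying by \<open>N / \<epsilon>\<close> gives the
  formula.\<close>

lemma linear_plus_sqrt_identity:
  fixes p h :: "'a::real_inner"
  assumes \<epsilon>: "\<epsilon> > 0" and h: "norm h \<le> \<epsilon>"
  defines "N \<equiv> sqrt (1 + (norm p)\<^sup>2)" and "s \<equiv> sqrt (\<epsilon>\<^sup>2 - (norm h)\<^sup>2)"
  shows "p \<bullet> h + s = \<epsilon> * N
           - N / (2 * \<epsilon>) * ((norm (h - (\<epsilon> / N) *\<^sub>R p))\<^sup>2 + (s - \<epsilon> / N)\<^sup>2)"
proof -
  have N: "N > 0" "(norm p)\<^sup>2 = N\<^sup>2 - 1"
    by (auto simp: N_def add_pos_nonneg)
  have s: "(norm h)\<^sup>2 = \<epsilon>\<^sup>2 - s\<^sup>2"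
    using power_mono[OF h, of 2] by (simp add: s_def)
  have "(norm (h - (\<epsilon> / N) *\<^sub>R p))\<^sup>2
      = (norm h)\<^sup>2 - 2 * (\<epsilon> / N) * (p \<bullet> h) + (\<epsilon> / N)\<^sup>2 * (norm p)\<^sup>2"
    unfolding power2_norm_eq_inner
    by (simp add: inner_diff_left inner_diff_right inner_commute power2_eq_square)
  then show ?thesis
    using N \<epsilon> unfolding N(2) s by (simp add: field_simps power2_eq_square)
qed

text \<open>Bilinearity splits the difference into two terms, each with one factor
  \<open>h - m\<close>. The bound is linear in the distance, so a quadratic penalty can absorb
  it.\<close>

lemma quadratic_form_diff_le:
  fixes A :: "'a::real_inner \<Rightarrow> 'a"
  assumes "bounded_linear A" and K: "\<And>h. norm (A h) \<le> norm h * K"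
    and "norm h \<le> r" and "norm m \<le> r" and "0 \<le> K"
  shows "A h \<bullet> h - A m \<bullet> m \<le> 2 * K * r * norm (h - m)"
proof -
  interpret bounded_linear A by fact
  have "0 \<le> r" using assms(3) norm_ge_zero order_trans by blast
  note assms = assms this
  have "A h \<bullet> h - A m \<bullet> m = A (h - m) \<bullet> h + A m \<bullet> (h - m)"
    by (simp add: diff inner_diff_left inner_diff_right)
  also have "\<dots> \<le> norm (A (h - m)) * norm h + norm (A m) * norm (h - m)"
    by (intro add_mono norm_cauchy_schwarz)
  also have "\<dots> \<le> (norm (h - m) * K) * r + (norm m * K) * norm (h - m)"
    using assms by (intro add_mono mult_mono K) auto
  also have "\<dots> \<le> (norm (h - m) * K) * r + (r * K) * norm (h - m)"
    using assms by (intro add_mono mult_mono) auto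
  finally show ?thesis by (simp add: algebra_simps)
qed

text \<open>The upper bound compares every \<open>h\<close> with \<open>m\<close>; the lower bound
  just evaluates at \<open>m\<close>. Assuming the Taylor estimate for arbitrary \<open>p\<close>
  and \<open>A\<close> lets the result serve both \<phi> and its negative.\<close>

lemma S_plus_expansion:
  fixes u :: "real ^ 'n \<Rightarrow> real"
  assumes A: "bounded_linear A"
    and Taylor: "\<And>e. e > 0 \<Longrightarrow> \<exists>d>0. \<forall>h. norm h < d \<longrightarrow>
           \<bar>u (x + h) - (u x + p \<bullet> h + (A h \<bullet> h) / 2)\<bar> \<le> e * (norm h)\<^sup>2"
    and e: "e > 0"
  shows "\<exists>d>0. \<forall>\<epsilon>. 0 < \<epsilon> \<and> \<epsilon> < d \<longrightarrow>
           \<bar>S_plus \<epsilon> u x - (u x + \<epsilon> * sqrt (1 + (norm p)\<^sup>2)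
              + \<epsilon>\<^sup>2 / 2 * ((A p \<bullet> p) / (1 + (norm p)\<^sup>2)))\<bar> \<le> e * \<epsilon>\<^sup>2"
proof -
  interpret A: bounded_linear A by (rule A)
  obtain K where K: "K > 0" "\<And>h. norm (A h) \<le> norm h * K"
    using A.pos_bounded by blast
  obtain d where d: "d > 0" "\<And>h. norm h < d \<Longrightarrow>
      \<bar>u (x + h) - (u x + p \<bullet> h + (A h \<bullet> h) / 2)\<bar> \<le> e / 2 * (norm h)\<^sup>2"
    using Taylor[of "e / 2"] e by auto
  define N where "N = sqrt (1 + (norm p)\<^sup>2)"
  have N: "N \<ge> 1" "N\<^sup>2 = 1 + (norm p)\<^sup>2"
    by (auto simp: N_def)
  have pN: "norm p \<le> N"
    unfolding N_def by (rule real_le_rsqrt) simp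
  \<comment> \<open>One half of \<open>e\<close> pays for the Taylor remainder, the other for the
    absorption error \<open>K\<^sup>2 * \<epsilon> ^ 3 / 2\<close>; hence the threshold
    \<open>e / K\<^sup>2\<close>.\<close>
  have "\<bar>S_plus \<epsilon> u x - (u x + \<epsilon> * N + \<epsilon>\<^sup>2 / 2 * ((A p \<bullet> p) / N\<^sup>2))\<bar> \<le> e * \<epsilon>\<^sup>2"
    if \<epsilon>: "0 < \<epsilon>" "\<epsilon> < min d (e / K\<^sup>2)" for \<epsilon>
  proof -
    define m where "m = (\<epsilon> / N) *\<^sub>R p"
    have m: "norm m \<le> \<epsilon>"
      using pN N \<epsilon> by (simp add: m_def field_simps)
    have Am: "A m \<bullet> m = \<epsilon>\<^sup>2 * ((A p \<bullet> p) / N\<^sup>2)"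
      by (simp add: m_def A.scaleR power2_eq_square)
    define M where "M = u x + \<epsilon> * N + (A m \<bullet> m) / 2"
    define F where "F h = u (x + h) + sqrt (\<epsilon>\<^sup>2 - (norm h)\<^sup>2)" for h
    have rem: "\<bar>u (x + h) - (u x + p \<bullet> h + (A h \<bullet> h) / 2)\<bar> \<le> e / 2 * \<epsilon>\<^sup>2"
      if h: "norm h \<le> \<epsilon>" for h
    proof -
      have "e / 2 * (norm h)\<^sup>2 \<le> e / 2 * \<epsilon>\<^sup>2"
        using h e by (intro mult_left_mono power_mono) auto
      then show ?thesis using d(2)[of h] h \<epsilon> by linarith
    qed
    have upper: "F h \<le> M + e * \<epsilon>\<^sup>2" if h: "norm h \<le> \<epsilon>" for h
    proof -
      define t where "t = norm (h - m)"
      \<comment> \<open>The vertical part of the squared distance is discarded; the horizontal part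
        \<open>t\<^sup>2\<close> suffices.\<close>
      have "p \<bullet> h + sqrt (\<epsilon>\<^sup>2 - (norm h)\<^sup>2) \<le> \<epsilon> * N - N / (2 * \<epsilon>) * t\<^sup>2"
        unfolding linear_plus_sqrt_identity[OF \<epsilon>(1) h, of p, folded N_def]
        unfolding t_def m_def distrib_left
        using N \<epsilon> by simp
      moreover have "1 / (2 * \<epsilon>) * t\<^sup>2 \<le> N / (2 * \<epsilon>) * t\<^sup>2"
        using N \<epsilon> by (intro mult_right_mono divide_right_mono) auto
      moreover have "A h \<bullet> h - A m \<bullet> m \<le> 2 * K * \<epsilon> * t"
        unfolding t_def using K by (intro quadratic_form_diff_le A h m) auto
      \<comment> \<open>Completing the square: the left side is largest at
        \<open>t = K * \<epsilon>\<^sup>2\<close>.\<close>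
      moreover have "K * \<epsilon> * t - 1 / (2 * \<epsilon>) * t\<^sup>2 \<le> K\<^sup>2 * \<epsilon> ^ 3 / 2"
      proof -
        have "K\<^sup>2 * \<epsilon> ^ 3 / 2 - (K * \<epsilon> * t - 1 / (2 * \<epsilon>) * t\<^sup>2) = (t - K * \<epsilon>\<^sup>2)\<^sup>2 / (2 * \<epsilon>)"
          using \<epsilon> by (simp add: field_simps power2_eq_square power3_eq_cube)
        also have "\<dots> \<ge> 0" using \<epsilon> by simp
        finally show ?thesis by simp
      qed
      moreover have "K\<^sup>2 * \<epsilon> ^ 3 / 2 \<le> e / 2 * \<epsilon>\<^sup>2"
      proof -
        have "K\<^sup>2 * \<epsilon> \<le> e" using \<epsilon> K by (simp add: field_simps)
        then have "K\<^sup>2 * \<epsilon> * \<epsilon>\<^sup>2 \<le> e * \<epsilon>\<^sup>2" by (intro mult_right_mono) auto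
        then show ?thesis by (simp add: power2_eq_square power3_eq_cube mult_ac)
      qed
      ultimately show ?thesis
        using rem[OF h] unfolding F_def M_def by linarith
    qed
    have lower: "M - e * \<epsilon>\<^sup>2 \<le> F m"
    proof -
      \<comment> \<open>The half sphere has height \<open>\<epsilon> / N\<close> above
        \<open>m\<close>, so both squares in the identity vanish there.\<close>
      have "(norm m)\<^sup>2 = (\<epsilon> / N)\<^sup>2 * (N\<^sup>2 - 1)"
        using N \<epsilon> by (simp add: m_def power_mult_distrib power_divide)
      moreover have "\<epsilon>\<^sup>2 = (\<epsilon> / N)\<^sup>2 * N\<^sup>2"
        using N(1) by (simp add: power_divide)
      ultimately have "\<epsilon>\<^sup>2 - (norm m)\<^sup>2 = (\<epsilon> / N)\<^sup>2"
        by (simp only: right_diff_distrib)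
      then have "sqrt (\<epsilon>\<^sup>2 - (norm m)\<^sup>2) = \<epsilon> / N"
        using N \<epsilon> by simp
      then have "p \<bullet> m + sqrt (\<epsilon>\<^sup>2 - (norm m)\<^sup>2) = \<epsilon> * N"
        using linear_plus_sqrt_identity[OF \<epsilon>(1) m, of p, folded N_def] by (simp add: m_def)
      moreover have "0 \<le> e * \<epsilon>\<^sup>2" using e by simp
      ultimately show ?thesis
        using rem[OF m] unfolding F_def M_def by linarith
    qed
    have S: "S_plus \<epsilon> u x = (SUP h\<in>{h. norm h \<le> \<epsilon>}. F h)"
      by (simp add: S_plus_def F_def)
    have "S_plus \<epsilon> u x \<le> M + e * \<epsilon>\<^sup>2"
      unfolding S using upper m by (intro cSUP_least) auto
    \<comment> \<open>A real supremum dominates its members only for a set bounded above;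
      \<open>upper\<close> supplies that bound.\<close>
    moreover have "F m \<le> S_plus \<epsilon> u x"
      unfolding S using upper m by (intro cSUP_upper bdd_aboveI2[where M = "M + e * \<epsilon>\<^sup>2"]) auto
    ultimately show ?thesis
      using lower unfolding M_def Am by (simp add: abs_le_iff)
  qed
  then show ?thesis
    using d(1) e K(1) unfolding N(2) N_def
    by (intro exI[of _ "min d (e / K\<^sup>2)"]) auto
qed

text \<open>The infimum on the reals is defined as the negated supremum of the negated set, so no
  boundedness is involved.\<close>

lemma S_minus_eq_S_plus: "S_minus \<epsilon> u x = - S_plus \<epsilon> (\<lambda>y. - u y) x"
  unfolding S_minus_def S_plus_def Inf_real_def image_image by simp

theorem proposition3p8:
  fixes U :: "(real ^ 'n) set" and \<phi> :: "real ^ 'n \<Rightarrow> real" and x :: "real ^ 'n"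
  assumes "open U" and "C2_on U \<phi>" and "x \<in> U"
  shows "(\<lambda>\<epsilon>. (S_plus \<epsilon> \<phi> x + S_minus \<epsilon> \<phi> x) / 2
              - (\<phi> x + \<epsilon>\<^sup>2 / 2 * (((hessian \<phi> x *v gradient \<phi> x) \<bullet> gradient \<phi> x)
                                  / (1 + (norm (gradient \<phi> x))\<^sup>2))))
         \<in> o[at 0 within {\<epsilon>. 0 < \<epsilon> \<and> closure (ball x \<epsilon>) \<subseteq> U}](\<lambda>\<epsilon>. \<epsilon>\<^sup>2)"
proof (rule landau_o.smallI)
  fix c :: real assume c: "c > 0"
  define p where "p = gradient \<phi> x"
  define A where "A = (\<lambda>h. hessian \<phi> x *v h)"
  obtain r where r: "r > 0" "ball x r \<subseteq> U"
    using assms openE by blast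
  have G: "GDERIV \<phi> y :> gradient \<phi> y" if "y \<in> ball x r" for y
    using that r assms by (intro GDERIV_gradient) (auto simp: C2_on_def)
  have A: "(gradient \<phi> has_derivative A) (at x)"
    using assms unfolding A_def hessian_def jacobian_works[symmetric] by (simp add: C2_on_def)
  then have blA: "bounded_linear A" "bounded_linear (\<lambda>h. - A h)"
    by (auto intro: has_derivative_bounded_linear bounded_linear_minus)
  note Taylor = second_order_Taylor_Peano[OF r(1) G A, folded p_def]
  obtain d1 where d1: "d1 > 0" "\<And>\<epsilon>. 0 < \<epsilon> \<and> \<epsilon> < d1 \<Longrightarrow>
      \<bar>S_plus \<epsilon> \<phi> x - (\<phi> x + \<epsilon> * sqrt (1 + (norm p)\<^sup>2)
        + \<epsilon>\<^sup>2 / 2 * ((A p \<bullet> p) / (1 + (norm p)\<^sup>2)))\<bar> \<le> c * \<epsilon>\<^sup>2"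
    using S_plus_expansion[OF blA(1) Taylor c] by blast
  have "\<exists>d>0. \<forall>h. norm h < d \<longrightarrow>
      \<bar>- \<phi> (x + h) - (- \<phi> x + (- p) \<bullet> h + (- A h \<bullet> h) / 2)\<bar> \<le> e * (norm h)\<^sup>2"
    if e: "e > 0" for e
  proof -
    have "\<bar>- \<phi> (x + h) - (- \<phi> x + (- p) \<bullet> h + (- A h \<bullet> h) / 2)\<bar>
        = \<bar>\<phi> (x + h) - (\<phi> x + p \<bullet> h + (A h \<bullet> h) / 2)\<bar>" for h
      by simp
    then show ?thesis using Taylor[OF _ e] by simp
  qed
  from S_plus_expansion[OF blA(2) this c]
  obtain d2 where d2: "d2 > 0" "\<And>\<epsilon>. 0 < \<epsilon> \<and> \<epsilon> < d2 \<Longrightarrow>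
      \<bar>S_plus \<epsilon> (\<lambda>y. - \<phi> y) x - (- \<phi> x + \<epsilon> * sqrt (1 + (norm (- p))\<^sup>2)
        + \<epsilon>\<^sup>2 / 2 * ((- A (- p) \<bullet> (- p)) / (1 + (norm (- p))\<^sup>2)))\<bar> \<le> c * \<epsilon>\<^sup>2"
    by blast
  \<comment> \<open>The quadratic form is even, so replacing \<open>p\<close> and \<open>A\<close>
    by their negatives changes only its sign.\<close>
  have "- A (- p) \<bullet> (- p) = - (A p \<bullet> p)"
    using bounded_linear.linear[OF blA(1)] by (simp add: linear_neg)
  then have d2': "\<bar>- S_minus \<epsilon> \<phi> x - (- \<phi> x + \<epsilon> * sqrt (1 + (norm p)\<^sup>2)
        - \<epsilon>\<^sup>2 / 2 * ((A p \<bullet> p) / (1 + (norm p)\<^sup>2)))\<bar> \<le> c * \<epsilon>\<^sup>2"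
    if "0 < \<epsilon>" "\<epsilon> < d2" for \<epsilon>
    using d2(2)[of \<epsilon>] that by (simp add: S_minus_eq_S_plus)
  \<comment> \<open>In the average the terms in \<open>sqrt (1 + (norm p)\<^sup>2)\<close> cancel,
    the quadratic terms agree, and the two errors average to at most
    \<open>c * \<epsilon>\<^sup>2\<close>.\<close>
  have bound: "\<bar>(S_plus \<epsilon> \<phi> x + S_minus \<epsilon> \<phi> x) / 2
      - (\<phi> x + \<epsilon>\<^sup>2 / 2 * ((A p \<bullet> p) / (1 + (norm p)\<^sup>2)))\<bar> \<le> c * \<epsilon>\<^sup>2"
    if "0 < \<epsilon>" "\<epsilon> < min d1 d2" for \<epsilon>
    using d1(2)[of \<epsilon>] d2'[of \<epsilon>] that unfolding abs_le_iff by argo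
  show "\<forall>\<^sub>F \<epsilon> in at 0 within {\<epsilon>. 0 < \<epsilon> \<and> closure (ball x \<epsilon>) \<subseteq> U}.
      norm ((S_plus \<epsilon> \<phi> x + S_minus \<epsilon> \<phi> x) / 2
        - (\<phi> x + \<epsilon>\<^sup>2 / 2 * (((hessian \<phi> x *v gradient \<phi> x) \<bullet> gradient \<phi> x)
                            / (1 + (norm (gradient \<phi> x))\<^sup>2)))) \<le> c * norm (\<epsilon>\<^sup>2)"
    unfolding eventually_at
    using d1(1) d2(1) bound
    by (intro exI[of _ "min d1 d2"]) (auto simp: A_def p_def)
qed

end
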